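(* Let $n$ be a positive integer. Then $$A_n = \sum_{d\mid n} \mu\!\left(\frac{n}{d}\right) N_d,$$ where the sum runs over all positive divisors $d$ of $n$ and $\mu$ is the Möbius function.
   Context: $\mathbb{N}$ is the set of nonnegative integers. A numerical semigroup is a subset $S\subseteq\mathbb{N}$ that contains $0$, is closed under addition, and has finite complement in $\mathbb{N}$. Every numerical semigroup $S$ has a unique minimal generating set, which is finite; it is denoted $P(S)$ and its elements are called primitives. For $S\neq\mathbb{N}$ the Frobenius number $F(S)$ is the largest element of $\mathbb{N}\setminus S$; by convention $F(\mathbb{N})=-1$. For a positive integer $n$, $A_n$ denotes the number of numerical semigroups $S$ with $\max P(S)=n$, and $N_n$ denotes the number of numerical semigroups $S$ with $F(S)=n$. *)

theory Defs
  imports "HOL-Computational_Algebra.Computational_Algebra"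
begin

definition submonoid_nat :: "nat set \<Rightarrow> bool" where
  "submonoid_nat S \<longleftrightarrow> 0 \<in> S \<and> (\<forall>x\<in>S. \<forall>y\<in>S. x + y \<in> S)"

definition numerical_semigroup :: "nat set \<Rightarrow> bool" where
  "numerical_semigroup S \<longleftrightarrow> submonoid_nat S \<and> finite (- S)"

definition minimal_generating_set :: "nat set \<Rightarrow> nat set \<Rightarrow> bool" where
  "minimal_generating_set S A \<longleftrightarrow>
     submonoid_nat hull A = S \<and> (\<forall>B. B \<subset> A \<longrightarrow> submonoid_nat hull B \<noteq> S)"

text \<open>The description below is proper for every submonoid \<open>S\<close>; see
  \<open>ex1_minimal_generating_set\<close>.\<close>

definition primitives :: "nat set \<Rightarrow> nat set" where
  "primitives S = (THE A. minimal_generating_set S A)"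

definition frobenius_number :: "nat set \<Rightarrow> int" where
  "frobenius_number S = (if S = UNIV then -1 else int (Max (- S)))"

text \<open>The two families counted here are finite (\<open>finite_max_primitive\<close>,
  \<open>finite_frobenius\<close>), so \<open>card\<close> is the true number of their members.\<close>

definition count_max_primitive :: "nat \<Rightarrow> nat" where
  "count_max_primitive n = card {S. numerical_semigroup S \<and> Max (primitives S) = n}"

definition count_frobenius :: "nat \<Rightarrow> nat" where
  "count_frobenius n = card {S. numerical_semigroup S \<and> frobenius_number S = int n}"

definition moebius_mu :: "nat \<Rightarrow> int" where
  "moebius_mu n = (if squarefree n then (-1) ^ card (prime_factors n) else 0)"

lemma submonoid_nat_hull: "submonoid_nat (submonoid_nat hull A)"
  by (rule hull_in) (auto simp: submonoid_nat_def)

lemma ex1_minimal_generating_set: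
  assumes S: "submonoid_nat S"
  shows "\<exists>!A. minimal_generating_set S A"
proof -
  define P where "P = {p \<in> S. p \<noteq> 0 \<and> (\<forall>x\<in>S. \<forall>y\<in>S. p = x + y \<longrightarrow> x = 0 \<or> y = 0)}"
  have P_least: "P \<subseteq> A" if A: "submonoid_nat hull A = S" for A
  proof
    fix p assume p: "p \<in> P"
    show "p \<in> A"
    proof (rule ccontr)
      assume "p \<notin> A"
      moreover have "A \<subseteq> S" using A hull_subset[of A submonoid_nat] by simp
      ultimately have "A \<subseteq> S - {p}" by blast
      moreover have "submonoid_nat (S - {p})"
        unfolding submonoid_nat_def
      proof (intro conjI ballI)
        show "0 \<in> S - {p}" using S p by (simp add: submonoid_nat_def P_def)
      next
        fix x y assume xy: "x \<in> S - {p}" "y \<in> S - {p}"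
        then have "x + y \<in> S" using S by (simp add: submonoid_nat_def)
        moreover have "x + y \<noteq> p"
        proof
          assume "x + y = p"
          moreover have "\<forall>x\<in>S. \<forall>y\<in>S. p = x + y \<longrightarrow> x = 0 \<or> y = 0"
            using p by (simp add: P_def)
          ultimately have "x = 0 \<or> y = 0" using xy by blast
          with \<open>x + y = p\<close> xy show False by auto
        qed
        ultimately show "x + y \<in> S - {p}" by simp
      qed
      ultimately have "submonoid_nat hull A \<subseteq> S - {p}" by (rule hull_minimal)
      with A have "S \<subseteq> S - {p}" by simp
      moreover have "p \<in> S" using p by (simp add: P_def)
      ultimately show False by blast
    qed
  qed
  have "x \<in> submonoid_nat hull P" if "x \<in> S" for x
    using that
  proof (induction x rule: less_induct)
    case (less x)
    have H: "0 \<in> submonoid_nat hull P"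
        "\<And>x y. \<lbrakk>x \<in> submonoid_nat hull P; y \<in> submonoid_nat hull P\<rbrakk>
          \<Longrightarrow> x + y \<in> submonoid_nat hull P"
      using submonoid_nat_hull[of P] unfolding submonoid_nat_def[of "submonoid_nat hull P"] by blast+
    consider "x = 0" | "x \<in> P" | y z where "y \<in> S" "z \<in> S" "x = y + z" "y \<noteq> 0" "z \<noteq> 0"
      using less.prems unfolding P_def by blast
    then show ?case
    proof cases
      case 1
      with H show ?thesis by simp
    next
      case 2
      then show ?thesis by (rule hull_inc)
    next
      case 3
      with less.IH[of y] less.IH[of z] H show ?thesis by simp
    qed
  qed
  moreover have "submonoid_nat hull P \<subseteq> S"
    by (rule hull_minimal) (use S in \<open>auto simp: P_def\<close>)
  ultimately have P: "submonoid_nat hull P = S" by blast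
  show ?thesis
    unfolding minimal_generating_set_def
  proof (rule ex1I[of _ P])
    show "submonoid_nat hull P = S \<and> (\<forall>B. B \<subset> P \<longrightarrow> submonoid_nat hull B \<noteq> S)"
    proof (intro conjI allI impI)
      fix B assume "B \<subset> P"
      then show "submonoid_nat hull B \<noteq> S" using P_least[of B] by blast
    qed (rule P)
  next
    fix A assume A: "submonoid_nat hull A = S \<and> (\<forall>B. B \<subset> A \<longrightarrow> submonoid_nat hull B \<noteq> S)"
    then have "P \<subseteq> A" by (intro P_least) simp
    moreover have "\<not> P \<subset> A" using A P by blast
    ultimately show "A = P" by blast
  qed
qed

lemma minimal_generating_set_primitives:
  "submonoid_nat S \<Longrightarrow> minimal_generating_set S (primitives S)"
  unfolding primitives_def by (rule theI') (rule ex1_minimal_generating_set)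

lemma finite_primitives:
  assumes S: "numerical_semigroup S"
  shows "finite (primitives S)"
proof -
  from S have M: "submonoid_nat S" and "finite (- S)" by (auto simp: numerical_semigroup_def)
  then obtain m where "\<forall>x\<in>- S. x < m" using finite_nat_set_iff_bounded by blast
  then have m: "x \<in> S" if "m \<le> x" for x using that by (meson ComplI not_le)
  have gen: "submonoid_nat hull (primitives S) = S"
    and min: "\<And>B. B \<subset> primitives S \<Longrightarrow> submonoid_nat hull B \<noteq> S"
    using minimal_generating_set_primitives[OF M] by (auto simp: minimal_generating_set_def)
  define B where "B = S \<inter> {..2 * m + 1}"
  have "x \<in> submonoid_nat hull B" if "x \<in> S" for x
    using that
  proof (induction x rule: less_induct)
    case (less x)
    show ?case
    proof (cases "x \<le> 2 * m + 1")
      case True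
      with less.prems show ?thesis by (intro hull_inc) (simp add: B_def)
    next
      case False
      have "x - (m + 1) \<in> submonoid_nat hull B" "m + 1 \<in> submonoid_nat hull B"
        using False by (auto intro!: less.IH m)
      then have "x - (m + 1) + (m + 1) \<in> submonoid_nat hull B"
        using submonoid_nat_hull[of B] unfolding submonoid_nat_def by blast
      with False show ?thesis by simp
    qed
  qed
  moreover have "submonoid_nat hull B \<subseteq> S"
    by (rule hull_minimal) (use M in \<open>auto simp: B_def\<close>)
  ultimately have B: "submonoid_nat hull B = S" by blast
  have "p \<in> B" if p: "p \<in> primitives S" for p
  proof (rule ccontr)
    assume "p \<notin> B"
    with m have "p > 2 * m + 1"
      using p gen hull_inc[of p "primitives S" submonoid_nat] by (force simp: B_def)
    have "B \<subseteq> submonoid_nat hull (primitives S - {p})"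
    proof
      fix x assume x: "x \<in> B"
      have T: "submonoid_nat ((submonoid_nat hull (primitives S - {p})) \<union> {p..})"
        using submonoid_nat_hull[of "primitives S - {p}"] by (auto simp: submonoid_nat_def)
      have "submonoid_nat hull (primitives S)
              \<subseteq> (submonoid_nat hull (primitives S - {p})) \<union> {p..}"
        proof (rule hull_minimal)
        show "primitives S \<subseteq> (submonoid_nat hull (primitives S - {p})) \<union> {p..}"
          using hull_subset[of "primitives S - {p}" submonoid_nat] by auto
      qed (rule T)
      with x gen \<open>p > 2 * m + 1\<close> show "x \<in> submonoid_nat hull (primitives S - {p})"
        by (auto simp: B_def)
    qed
    then have "submonoid_nat hull B \<subseteq> submonoid_nat hull (primitives S - {p})"
      by (rule hull_minimal) (rule submonoid_nat_hull)
    moreover have "submonoid_nat hull (primitives S - {p}) \<subseteq> S"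
      using gen hull_mono[of "primitives S - {p}" "primitives S" submonoid_nat] by auto
    ultimately have "submonoid_nat hull (primitives S - {p}) = S" using B by blast
    with min[of "primitives S - {p}"] p show False by blast
  qed
  then have "primitives S \<subseteq> B" by blast
  then show ?thesis by (rule finite_subset) (simp add: B_def)
qed

lemma finite_max_primitive: "finite {S. numerical_semigroup S \<and> Max (primitives S) = n}"
proof (rule finite_subset)
  show "{S. numerical_semigroup S \<and> Max (primitives S) = n}
          \<subseteq> (\<lambda>A. submonoid_nat hull A) ` Pow {..n}"
  proof
    fix S assume S: "S \<in> {S. numerical_semigroup S \<and> Max (primitives S) = n}"
    then have M: "submonoid_nat S" by (simp add: numerical_semigroup_def)
    have "submonoid_nat hull (primitives S) = S"
      using minimal_generating_set_primitives[OF M] unfolding minimal_generating_set_def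
      by (rule conjunct1)
    then have "S = submonoid_nat hull (primitives S)" by (rule sym)
    moreover have "primitives S \<in> Pow {..n}"
    proof -
      from S have "finite (primitives S)" "Max (primitives S) = n"
        using finite_primitives by blast+
      then have "x \<le> n" if "x \<in> primitives S" for x using that Max_ge by blast
      then show ?thesis by blast
    qed
    ultimately show "S \<in> (\<lambda>A. submonoid_nat hull A) ` Pow {..n}" by (rule image_eqI)
  qed
qed simp

lemma finite_frobenius: "finite {S. numerical_semigroup S \<and> frobenius_number S = int n}"
proof (rule finite_subset)
  show "{S. numerical_semigroup S \<and> frobenius_number S = int n} \<subseteq> uminus ` Pow {..n}"
  proof
    fix S assume S: "S \<in> {S. numerical_semigroup S \<and> frobenius_number S = int n}"
    then have "finite (- S)" "Max (- S) = n"
      by (auto simp: numerical_semigroup_def frobenius_number_def split: if_splits)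
    then have "x \<le> n" if "x \<in> - S" for x using that Max_ge by blast
    then have "- S \<in> Pow {..n}" by blast
    moreover have "S = - (- S)" by simp
    ultimately show "S \<in> uminus ` Pow {..n}" by (rule rev_image_eqI)
  qed
qed simp

end

theory Submission
  imports Defs
begin

text \<open>Call a submonoid of \<open>\<nat>\<close> \<open>n\<close>-topped if its largest irreducible element is \<open>n\<close>.
  If \<open>M\<close> is \<open>n\<close>-topped, then \<open>M - {n} \<union> {n<..}\<close> is a numerical semigroup with Frobenius number
  \<open>n\<close>; conversely, \<open>M\<close> is generated by \<open>n\<close> and the elements below \<open>n\<close> of this semigroup. So \<open>N\<^sub>n\<close>
  counts the \<open>n\<close>-topped submonoids. Dividing such a submonoid by its greatest common divisor \<open>e\<close>
  gives a numerical semigroup with largest primitive \<open>n div e\<close>, hence \<open>N\<^sub>n = (\<Sum>d | d dvd n. A\<^sub>d)\<close>, and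
  Moebius inversion gives the claim.\<close>

section \<open>Irreducible elements of submonoids\<close>

text \<open>The atoms of \<open>S\<close>. On submonoids this is an elementwise form of
  \<open>primitives\<close>, free of the description operator.\<close>

definition irreducibles :: "nat set \<Rightarrow> nat set" where
  "irreducibles S = {p \<in> S. p \<noteq> 0 \<and> (\<forall>x\<in>S. \<forall>y\<in>S. p = x + y \<longrightarrow> x = 0 \<or> y = 0)}"

lemma submonoid_natI:
  "0 \<in> S \<Longrightarrow> (\<And>x y. x \<in> S \<Longrightarrow> y \<in> S \<Longrightarrow> x + y \<in> S) \<Longrightarrow> submonoid_nat S"
  by (simp add: submonoid_nat_def)

lemma submonoid_nat_0: "submonoid_nat S \<Longrightarrow> 0 \<in> S"
  by (simp add: submonoid_nat_def)

lemma submonoid_nat_add: "submonoid_nat S \<Longrightarrow> x \<in> S \<Longrightarrow> y \<in> S \<Longrightarrow> x + y \<in> S"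
  by (simp add: submonoid_nat_def)

lemma submonoid_nat_mult:
  assumes "submonoid_nat S" "x \<in> S"
  shows "k * x \<in> S"
  by (induction k) (auto intro: submonoid_nat_0 submonoid_nat_add assms)

lemma irreducibles_subset: "irreducibles S \<subseteq> S"
  by (auto simp: irreducibles_def)

text \<open>Deleting an irreducible element from a submonoid leaves a submonoid. If \<open>A\<close>
  missed the element, this would be a smaller submonoid containing \<open>A\<close>.\<close>

lemma irreducibles_hull_subset: "irreducibles (submonoid_nat hull A) \<subseteq> A"
proof
  fix p assume p: "p \<in> irreducibles (submonoid_nat hull A)"
  let ?S = "submonoid_nat hull A"
  show "p \<in> A"
  proof (rule ccontr)
    assume "p \<notin> A"
    have "submonoid_nat (?S - {p})"
    proof (rule submonoid_natI)
      show "0 \<in> ?S - {p}"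
        using p submonoid_nat_0[OF submonoid_nat_hull] by (simp add: irreducibles_def)
    next
      fix x y assume xy: "x \<in> ?S - {p}" "y \<in> ?S - {p}"
      then have "x + y \<in> ?S" by (simp add: submonoid_nat_add[OF submonoid_nat_hull])
      moreover have "x + y \<noteq> p"
      proof
        assume eq: "x + y = p"
        with p xy have "x = 0 \<or> y = 0" unfolding irreducibles_def by blast
        with eq xy show False by auto
      qed
      ultimately show "x + y \<in> ?S - {p}" by simp
    qed
    moreover have "A \<subseteq> ?S - {p}" using \<open>p \<notin> A\<close> hull_subset[of A submonoid_nat] by blast
    ultimately have "?S \<subseteq> ?S - {p}" by (intro hull_minimal)
    then show False using p irreducibles_subset by blast
  qed
qed

text \<open>By strong induction: a nonzero element that is not irreducible splits into two strictly
  smaller elements of \<open>S\<close>.\<close>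

lemma hull_irreducibles:
  assumes S: "submonoid_nat S"
  shows "submonoid_nat hull irreducibles S = S"
proof
  show "submonoid_nat hull irreducibles S \<subseteq> S"
    using irreducibles_subset S by (rule hull_minimal)
  show "S \<subseteq> submonoid_nat hull irreducibles S"
  proof
    fix x assume "x \<in> S"
    then show "x \<in> submonoid_nat hull irreducibles S"
    proof (induction x rule: less_induct)
      case (less x)
      consider "x = 0" | "x \<in> irreducibles S"
        | y z where "y \<in> S" "z \<in> S" "x = y + z" "y \<noteq> 0" "z \<noteq> 0"
        using less.prems unfolding irreducibles_def by blast
      then show ?case
      proof cases
        case 1
        then show ?thesis by (simp add: submonoid_nat_0[OF submonoid_nat_hull])
      next
        case 2
        then show ?thesis by (rule hull_inc)
      next
        case 3
        with less.IH[of y] less.IH[of z] show ?thesis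
          by (simp add: submonoid_nat_add[OF submonoid_nat_hull])
      qed
    qed
  qed
qed

text \<open>The irreducibles generate \<open>S\<close> and lie in every generating set, so
  minimality of \<open>primitives S\<close> forces equality.\<close>

lemma primitives_eq_irreducibles:
  assumes S: "submonoid_nat S"
  shows "primitives S = irreducibles S"
proof -
  have gen: "submonoid_nat hull primitives S = S"
    and min: "\<And>B. B \<subset> primitives S \<Longrightarrow> submonoid_nat hull B \<noteq> S"
    using minimal_generating_set_primitives[OF S] by (auto simp: minimal_generating_set_def)
  have "irreducibles S \<subseteq> primitives S"
    using irreducibles_hull_subset[of "primitives S"] by (simp add: gen)
  with min[of "irreducibles S"] hull_irreducibles[OF S] show ?thesis by blast
qed

lemma irreducibles_image_mult:
  assumes "e > 0"
  shows "irreducibles ((*) e ` S) = (*) e ` irreducibles S"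
  using assms by (auto simp: irreducibles_def simp flip: distrib_left)

section \<open>Greatest common divisors of submonoids\<close>

text \<open>The least positive difference \<open>k\<close> of two elements divides every element: a nonzero remainder
  modulo \<open>k\<close> would be a smaller positive difference.\<close>

lemma consecutive_elements:
  assumes S: "submonoid_nat S" and "Gcd S = 1"
  obtains y where "y \<in> S" "y + 1 \<in> S"
proof -
  define P where "P k \<longleftrightarrow> k > 0 \<and> (\<exists>y\<in>S. y + k \<in> S)" for k
  have "\<exists>x\<in>S. x \<noteq> 0" using \<open>Gcd S = 1\<close> Gcd_0_iff[of S] by auto
  then have ex: "\<exists>k. P k" using submonoid_nat_0[OF S] unfolding P_def
    by (metis add_0 gr0I)
  define k where "k = (LEAST k. P k)"
  have "P k" unfolding k_def by (rule LeastI_ex[OF ex])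
  then obtain y where k: "k > 0" "y \<in> S" "y + k \<in> S" by (auto simp: P_def)
  have "k dvd s" if "s \<in> S" for s
  proof (rule ccontr)
    assume "\<not> k dvd s"
    then have r: "s mod k > 0" by (simp add: dvd_eq_mod_eq_0)
    \<comment> \<open>With \<open>q = s div k\<close>, the elements \<open>q * (y + k)\<close> and
      \<open>s + q * y\<close> of \<open>S\<close> differ by exactly \<open>s mod k\<close>.\<close>
    have "s div k * (y + k) \<in> S" using k by (intro submonoid_nat_mult[OF S])
    moreover have "s div k * (y + k) + s mod k = s + s div k * y"
      using div_mult_mod_eq[of s k] by (simp add: algebra_simps)
    moreover have "s + s div k * y \<in> S"
      using k that by (intro submonoid_nat_add[OF S] submonoid_nat_mult[OF S])
    ultimately have "P (s mod k)" using r by (metis P_def)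
    then have "k \<le> s mod k" unfolding k_def by (rule Least_le)
    with mod_less_divisor[OF k(1), of s] show False by simp
  qed
  then have "k dvd Gcd S" by (rule Gcd_greatest)
  with \<open>Gcd S = 1\<close> k that show thesis by simp
qed

text \<open>A cofinite set contains two consecutive numbers, which are coprime. Conversely,
  consecutive elements \<open>y\<close> and \<open>y + 1\<close> generate everything from
  \<open>y * y\<close> on.\<close>

lemma numerical_semigroup_iff_Gcd:
  "numerical_semigroup S \<longleftrightarrow> submonoid_nat S \<and> Gcd S = 1"
proof (intro iffI conjI; (elim conjE)?)
  assume S: "numerical_semigroup S"
  then show "submonoid_nat S" by (simp add: numerical_semigroup_def)
  from S have "finite (- S)" by (simp add: numerical_semigroup_def)
  then obtain m where "\<forall>x\<in>- S. x < m" using finite_nat_set_iff_bounded by blast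
  then have "x \<in> S" if "m \<le> x" for x using that by (meson ComplI not_le)
  then have "Gcd S dvd m" "Gcd S dvd Suc m" by auto
  then have "Gcd S dvd Suc m - m" by (rule dvd_diff_nat[rotated])
  then show "Gcd S = 1" by simp
next
  assume S: "submonoid_nat S" and "Gcd S = 1"
  then obtain y where y: "y \<in> S" "y + 1 \<in> S" by (rule consecutive_elements)
  have "x \<in> S" if "x \<ge> y * y" for x
  proof (cases "y = 0")
    case True
    with y(2) have "1 \<in> S" by simp
    then show ?thesis using submonoid_nat_mult[OF S, of 1 x] by simp
  next
    case False
    then have "x mod y < y" by simp
    moreover have "y \<le> x div y" using False div_le_mono[OF that, of y] by simp
    ultimately have "x mod y \<le> x div y" by linarith
    then obtain q where q: "x div y = x mod y + q" using le_Suc_ex by blast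
    \<comment> \<open>The remainder is absorbed by replacing \<open>x mod y\<close> of the
      \<open>x div y\<close> copies of \<open>y\<close> by \<open>y + 1\<close>; there are enough
      copies because \<open>x mod y < y \<le> x div y\<close>.\<close>
    have "x = q * y + x mod y * (y + 1)"
      using div_mult_mod_eq[of x y] unfolding q by (simp add: algebra_simps)
    moreover have "q * y + x mod y * (y + 1) \<in> S"
      using S y by (blast intro: submonoid_nat_add submonoid_nat_mult)
    ultimately show ?thesis by simp
  qed
  then have "- S \<subseteq> {..<y * y}" by (auto simp: not_le[symmetric])
  with S show "numerical_semigroup S"
    by (auto simp: numerical_semigroup_def intro: finite_subset)
qed

lemma Gcd_image_mult_nat: "Gcd ((*) e ` S) = e * Gcd S" for e :: nat
  using Gcd_mult[of e S] by simp

section \<open>Counting submonoids by their largest irreducible element\<close>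

text \<open>The gcd is left free: sorting by it later produces the sum over divisors. Membership
  plus a bound replaces \<open>Max\<close>, which is meaningful only for finite nonempty
  sets.\<close>

definition topped_submonoids :: "nat \<Rightarrow> nat set set" where
  "topped_submonoids n =
     {M. submonoid_nat M \<and> n \<in> irreducibles M \<and> irreducibles M \<subseteq> {..n}}"

lemma numerical_semigroup_max_primitive_eq:
  "{S. numerical_semigroup S \<and> Max (primitives S) = n} =
     {S \<in> topped_submonoids n. Gcd S = 1}"
proof -
  have "Max (primitives S) = n \<longleftrightarrow> n \<in> irreducibles S \<and> irreducibles S \<subseteq> {..n}"
    if S: "numerical_semigroup S" for S
  proof -
    have M: "submonoid_nat S" and G: "Gcd S = 1"
      using S by (auto simp: numerical_semigroup_iff_Gcd)
    \<comment> \<open>\<open>Max\<close> can be unfolded only for a nonempty set. Without primitives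
      \<open>S\<close> would be \<open>{0}\<close>, whose gcd is 0.\<close>
    have "primitives S \<noteq> {}"
    proof
      assume "primitives S = {}"
      then have "S = submonoid_nat hull {}"
        using hull_irreducibles[OF M] primitives_eq_irreducibles[OF M] by simp
      also have "\<dots> \<subseteq> {0}" by (rule hull_minimal) (auto intro: submonoid_natI)
      finally have "Gcd S = 0" by (simp add: Gcd_0_iff)
      with G show False by simp
    qed
    with finite_primitives[OF S] have "Max (primitives S) = n \<longleftrightarrow>
        n \<in> primitives S \<and> (\<forall>x\<in>primitives S. x \<le> n)"
      by (rule Max_eq_iff)
    then show ?thesis by (auto simp: primitives_eq_irreducibles[OF M])
  qed
  then show ?thesis by (auto simp: topped_submonoids_def numerical_semigroup_iff_Gcd)
qed

text \<open>The generating set contains all irreducibles of \<open>M\<close>. Hence \<open>M\<close>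
  can be recovered from \<open>n\<close> and its elements below \<open>n\<close>.\<close>

lemma topped_submonoids_generated:
  assumes "M \<in> topped_submonoids n"
  shows "submonoid_nat hull insert n (M \<inter> {..<n}) = M"
proof
  have M: "submonoid_nat M" "n \<in> M" "irreducibles M \<subseteq> {..n}"
    using assms irreducibles_subset by (auto simp: topped_submonoids_def)
  then show "submonoid_nat hull insert n (M \<inter> {..<n}) \<subseteq> M" by (intro hull_minimal) auto
  have "irreducibles M \<subseteq> insert n (M \<inter> {..<n})"
    using M irreducibles_subset[of M] by force
  then have "submonoid_nat hull irreducibles M \<subseteq> submonoid_nat hull insert n (M \<inter> {..<n})"
    by (rule hull_mono)
  then show "M \<subseteq> submonoid_nat hull insert n (M \<inter> {..<n})"
    by (simp add: hull_irreducibles[OF M(1)])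
qed

lemma frobenius_number_eq_iff:
  assumes "finite (- S)"
  shows "frobenius_number S = int n \<longleftrightarrow> n \<notin> S \<and> {n<..} \<subseteq> S"
\<comment> \<open>For \<open>UNIV\<close> both sides fail, since the conventional value -1 is not of
  the form \<open>int n\<close>.\<close>
proof (cases "S = UNIV")
  case False
  then have "Max (- S) = n \<longleftrightarrow> n \<in> - S \<and> (\<forall>x\<in>- S. x \<le> n)"
    using assms by (intro Max_eq_iff) auto
  also have "\<dots> \<longleftrightarrow> n \<notin> S \<and> {n<..} \<subseteq> S" by (auto simp: not_le[symmetric])
  finally show ?thesis using False by (simp add: frobenius_number_def)
qed (simp add: frobenius_number_def)

text \<open>Both maps of the bijection preserve the elements below \<open>n\<close>, and these
  determine the set on either side.\<close>

lemma count_frobenius_eq_card_topped: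
  assumes "n > 0"
  shows "count_frobenius n = card (topped_submonoids n)"
proof -
  have frob: "numerical_semigroup S \<and> frobenius_number S = int n \<longleftrightarrow>
      submonoid_nat S \<and> n \<notin> S \<and> {n<..} \<subseteq> S" for S
  proof -
    have "finite (- S)" if "{n<..} \<subseteq> S"
      by (rule finite_subset[of _ "{..n}"]) (use that in \<open>auto simp: not_le[symmetric]\<close>)
    then show ?thesis
      using frobenius_number_eq_iff[of S n] unfolding numerical_semigroup_def by blast
  qed
  have "bij_betw (\<lambda>M. M - {n} \<union> {n<..}) (topped_submonoids n)
      {S. numerical_semigroup S \<and> frobenius_number S = int n}"
  proof (rule bij_betw_byWitness[where f' = "\<lambda>S. submonoid_nat hull insert n (S \<inter> {..<n})"])
    show "\<forall>M\<in>topped_submonoids n.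
        submonoid_nat hull insert n ((M - {n} \<union> {n<..}) \<inter> {..<n}) = M"
    proof
      fix M assume M: "M \<in> topped_submonoids n"
      have "(M - {n} \<union> {n<..}) \<inter> {..<n} = M \<inter> {..<n}" by auto
      with topped_submonoids_generated[OF M]
      show "submonoid_nat hull insert n ((M - {n} \<union> {n<..}) \<inter> {..<n}) = M" by simp
    qed
    show "(\<lambda>M. M - {n} \<union> {n<..}) ` topped_submonoids n
        \<subseteq> {S. numerical_semigroup S \<and> frobenius_number S = int n}"
    proof clarify
      fix M assume "M \<in> topped_submonoids n"
      then have M: "submonoid_nat M" "n \<in> irreducibles M" by (auto simp: topped_submonoids_def)
      have "submonoid_nat (M - {n} \<union> {n<..})"
      proof (rule submonoid_natI)
        show "0 \<in> M - {n} \<union> {n<..}" using M \<open>n > 0\<close> by (simp add: submonoid_nat_0)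
      next
        fix x y assume xy: "x \<in> M - {n} \<union> {n<..}" "y \<in> M - {n} \<union> {n<..}"
        show "x + y \<in> M - {n} \<union> {n<..}"
        proof (cases "x > n \<or> y > n")
          case False
          with xy have xy': "x \<in> M" "y \<in> M" "x \<noteq> n" "y \<noteq> n" by auto
          \<comment> \<open>Irreducibility of \<open>n\<close> is what keeps the set closed under
            addition after \<open>n\<close> is removed.\<close>
          have "x + y \<noteq> n"
          proof
            assume eq: "x + y = n"
            with M(2) xy' have "x = 0 \<or> y = 0" unfolding irreducibles_def by blast
            with eq xy' show False by auto
          qed
          with submonoid_nat_add[OF M(1)] xy' show ?thesis by auto
        qed auto
      qed
      then show "numerical_semigroup (M - {n} \<union> {n<..}) \<and>
          frobenius_number (M - {n} \<union> {n<..}) = int n"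
        unfolding frob by auto
    qed
    \<comment> \<open>Adjoining \<open>n\<close> creates nothing new below \<open>n\<close>, as
      every sum that uses \<open>n\<close> is at least \<open>n\<close>. A proper splitting of
      \<open>n\<close> would therefore lie in \<open>S\<close>, which omits
      \<open>n\<close>.\<close>
    have key: "(submonoid_nat hull insert n (S \<inter> {..<n})) \<inter> {..<n} = S \<inter> {..<n} \<and>
        submonoid_nat hull insert n (S \<inter> {..<n}) \<in> topped_submonoids n"
      if S: "submonoid_nat S" "n \<notin> S" for S
    proof -
      define M where "M = submonoid_nat hull insert n (S \<inter> {..<n})"
      have "submonoid_nat (S \<inter> {..<n} \<union> {n..})"
        using S \<open>n > 0\<close> by (auto simp: submonoid_nat_def)
      then have "M \<subseteq> S \<inter> {..<n} \<union> {n..}" unfolding M_def by (intro hull_minimal) auto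
      moreover have sub: "insert n (S \<inter> {..<n}) \<subseteq> M" unfolding M_def by (rule hull_subset)
      ultimately have eq: "M \<inter> {..<n} = S \<inter> {..<n}" by auto
      have "n \<in> irreducibles M"
      proof -
        have "x = 0 \<or> y = 0" if xy: "x \<in> M" "y \<in> M" "n = x + y" for x y
        proof (rule ccontr)
          assume "\<not> (x = 0 \<or> y = 0)"
          with xy have "x \<in> M \<inter> {..<n}" "y \<in> M \<inter> {..<n}" by auto
          then have "x + y \<in> S" unfolding eq using submonoid_nat_add[OF S(1)] by blast
          with S(2) xy show False by simp
        qed
        with sub \<open>n > 0\<close> show ?thesis by (auto simp: irreducibles_def)
      qed
      moreover have "irreducibles M \<subseteq> insert n (S \<inter> {..<n})"
        unfolding M_def by (rule irreducibles_hull_subset)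
      then have "irreducibles M \<subseteq> {..n}" by auto
      moreover have "submonoid_nat M" unfolding M_def by (rule submonoid_nat_hull)
      ultimately show ?thesis using eq unfolding topped_submonoids_def M_def by simp
    qed
    show "\<forall>S\<in>{S. numerical_semigroup S \<and> frobenius_number S = int n}.
        (submonoid_nat hull insert n (S \<inter> {..<n})) - {n} \<union> {n<..} = S"
    proof
      fix S assume "S \<in> {S. numerical_semigroup S \<and> frobenius_number S = int n}"
      then have S: "submonoid_nat S" "n \<notin> S" "{n<..} \<subseteq> S" by (auto simp: frob)
      define M where "M = submonoid_nat hull insert n (S \<inter> {..<n})"
      have M: "M \<inter> {..<n} = S \<inter> {..<n}" unfolding M_def using key[OF S(1,2)] by (rule conjunct1)
      have "A - {n} \<union> {n<..} = A \<inter> {..<n} \<union> {n<..}" for A by auto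
      then have "M - {n} \<union> {n<..} = S - {n} \<union> {n<..}" by (simp only: M)
      also have "\<dots> = S" using S by auto
      finally show "(submonoid_nat hull insert n (S \<inter> {..<n})) - {n} \<union> {n<..} = S"
        unfolding M_def .
    qed
    show "(\<lambda>S. submonoid_nat hull insert n (S \<inter> {..<n})) `
        {S. numerical_semigroup S \<and> frobenius_number S = int n} \<subseteq> topped_submonoids n"
      using key by (auto simp: frob)
  qed
  then show ?thesis unfolding count_frobenius_def by (rule bij_betw_same_card[symmetric])
qed

text \<open>Scaling by \<open>e > 0\<close> is an order-preserving monoid isomorphism onto its
  image, so it carries irreducibles to irreducibles.\<close>

lemma image_mult_in_topped_iff:
  assumes "e > 0"
  shows "(*) e ` S \<in> topped_submonoids (e * d) \<longleftrightarrow> S \<in> topped_submonoids d"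
proof -
  have "submonoid_nat ((*) e ` S) \<longleftrightarrow> submonoid_nat S"
    using assms by (auto simp: submonoid_nat_def image_iff simp flip: distrib_left)
  then show ?thesis
    using assms by (auto simp: topped_submonoids_def irreducibles_image_mult)
qed

lemma topped_submonoids_Gcd_eq:
  assumes "e > 0"
  shows "{M \<in> topped_submonoids (e * d). Gcd M = e} =
    (\<lambda>S. (*) e ` S) ` {S \<in> topped_submonoids d. Gcd S = 1}"
proof (intro equalityI subsetI)
  fix M assume M: "M \<in> {M \<in> topped_submonoids (e * d). Gcd M = e}"
  define S where "S = {x. e * x \<in> M}"
  have "e dvd x" if "x \<in> M" for x using M that by auto
  then have MS: "M = (*) e ` S" unfolding S_def by (auto elim!: dvdE)
  have "S \<in> topped_submonoids d"
    using M image_mult_in_topped_iff[OF assms, of S d] MS by simp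
  moreover have "e * Gcd S = e" using M by (simp add: MS Gcd_image_mult_nat)
  then have "Gcd S = 1" using assms by simp
  ultimately show "M \<in> (\<lambda>S. (*) e ` S) ` {S \<in> topped_submonoids d. Gcd S = 1}"
    using MS by blast
qed (use assms in \<open>auto simp: image_mult_in_topped_iff Gcd_image_mult_nat\<close>)

text \<open>The topped submonoids are partitioned by their gcd, which divides \<open>n\<close>
  because \<open>n\<close> is an element. The class with gcd \<open>n div d\<close> is a scaled copy
  of the family counted by \<open>count_max_primitive d\<close>.\<close>

lemma count_frobenius_eq_sum_count_max_primitive:
  assumes "n > 0"
  shows "count_frobenius n = (\<Sum>d | d dvd n. count_max_primitive d)"
proof -
  let ?T = "\<lambda>e. {M \<in> topped_submonoids n. Gcd M = e}"
  have card: "card (?T (n div d)) = count_max_primitive d"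
    and fin: "finite (?T (n div d))" if "d dvd n" for d
  proof -
    let ?A = "{S. numerical_semigroup S \<and> Max (primitives S) = d}"
    have e: "n div d > 0" "n div d * d = n" using that assms by (auto elim!: dvdE)
    have T: "?T (n div d) = (\<lambda>S. (*) (n div d) ` S) ` ?A"
      using topped_submonoids_Gcd_eq[OF e(1), of d]
      by (simp only: e numerical_semigroup_max_primitive_eq)
    have "inj ((*) (n div d))" using e(1) by (simp add: inj_on_def)
    then have "inj_on (\<lambda>S. (*) (n div d) ` S) ?A" by (simp add: inj_on_def inj_image_eq_iff)
    then show "card (?T (n div d)) = count_max_primitive d"
      unfolding T count_max_primitive_def by (rule card_image)
    show "finite (?T (n div d))" unfolding T by (intro finite_imageI finite_max_primitive)
  qed
  have "topped_submonoids n = (\<Union>d\<in>{d. d dvd n}. ?T (n div d))"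
  proof safe
    fix M assume M: "M \<in> topped_submonoids n"
    then have "n \<in> M" using irreducibles_subset by (auto simp: topped_submonoids_def)
    then have "Gcd M dvd n" by (rule Gcd_dvd)
    then have "n div Gcd M dvd n" "n div (n div Gcd M) = Gcd M"
      using assms by (auto elim!: dvdE)
    with M show "M \<in> (\<Union>d\<in>{d. d dvd n}. ?T (n div d))" by (intro UN_I[of "n div Gcd M"]) auto
  qed
  moreover have "card (\<Union>d\<in>{d. d dvd n}. ?T (n div d)) = (\<Sum>d | d dvd n. card (?T (n div d)))"
  proof (rule card_UN_disjoint)
    show "finite {d. d dvd n}" using assms by simp
    show "\<forall>d\<in>{d. d dvd n}. finite (?T (n div d))" using fin by blast
    \<comment> \<open>Distinct divisors have distinct cofactors, so the gcd classes are
      disjoint.\<close>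
    have "inj_on (\<lambda>d. n div d) {d. d dvd n}"
      using assms by (intro inj_onI) (metis dvd_div_mult_self mem_Collect_eq mult_cancel1
        mult_eq_0_iff not_less0)
    then show "\<forall>d\<in>{d. d dvd n}. \<forall>d'\<in>{d. d dvd n}. d \<noteq> d' \<longrightarrow> ?T (n div d) \<inter> ?T (n div d') = {}"
      by (auto dest: inj_onD)
  qed
  ultimately show ?thesis
    using card by (simp add: count_frobenius_eq_card_topped[OF assms])
qed

section \<open>Moebius inversion\<close>

text \<open>A new prime factor preserves squarefreeness, or its failure, and raises the number of
  prime factors by one.\<close>

lemma moebius_mu_prime_mult:
  assumes p: "prime p" and "\<not> p dvd d"
  shows "moebius_mu (p * d) = - moebius_mu d"
proof -
  have "d \<noteq> 0" using assms by (intro notI) simp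
  have "coprime p d" using assms by (simp add: prime_imp_coprime)
  then have "squarefree (p * d) \<longleftrightarrow> squarefree d"
    using squarefree_mult_coprime[of p d] squarefree_multD(2)[of p d] squarefree_prime[OF p]
    by blast
  moreover have "prime_factors (p * d) = insert p (prime_factors d)"
    using p \<open>d \<noteq> 0\<close> by (simp add: prime_factors_product prime_prime_factors)
  moreover have "p \<notin> prime_factors d" using assms by auto
  ultimately show ?thesis by (simp add: moebius_mu_def)
qed

text \<open>For a prime factor \<open>p\<close> of \<open>n\<close>, the squarefree divisors \<open>d\<close> and \<open>p * d\<close> with \<open>\<not> p dvd d\<close> cancel.\<close>

lemma sum_moebius_mu:
  assumes "n > 0"
  shows "(\<Sum>d | d dvd n. moebius_mu d) = (if n = 1 then 1 else 0)"
proof (cases "n = 1")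
  case True
  then show ?thesis by (simp add: moebius_mu_def)
next
  case False
  then obtain p where p: "prime p" "p dvd n" using prime_factor_nat by blast
  let ?A = "{d. d dvd n \<and> \<not> p dvd d}"
  have fin: "finite {d. d dvd n}" using assms by simp
  have inj: "inj_on ((*) p) ?A" using p by (auto simp: inj_on_def dest: prime_gt_0_nat)
  have "(\<Sum>d | d dvd n. moebius_mu d) = (\<Sum>d \<in> ?A \<union> (*) p ` ?A. moebius_mu d)"
  proof (rule sum.mono_neutral_right[OF fin])
    show "?A \<union> (*) p ` ?A \<subseteq> {d. d dvd n}"
      using p by (auto intro: divides_mult prime_imp_coprime)
    \<comment> \<open>The divisors left out are multiples of \<open>p ^ 2\<close>, where the Moebius
      function vanishes.\<close>
    show "\<forall>d\<in>{d. d dvd n} - (?A \<union> (*) p ` ?A). moebius_mu d = 0"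
    proof
      fix d assume d: "d \<in> {d. d dvd n} - (?A \<union> (*) p ` ?A)"
      then obtain c where c: "d = p * c" by auto
      moreover from this d have "c dvd n" using dvd_mult_right by auto
      ultimately have "p dvd c" using d by auto
      then have "p ^ 2 dvd d" by (simp add: c power2_eq_square)
      then have "\<not> squarefree d" using p unfolding squarefree_def by auto
      then show "moebius_mu d = 0" by (simp add: moebius_mu_def)
    qed
  qed
  also have "\<dots> = (\<Sum>d\<in>?A. moebius_mu d) + (\<Sum>d\<in>(*) p ` ?A. moebius_mu d)"
    using fin by (intro sum.union_disjoint) auto
  also have "(\<Sum>d\<in>(*) p ` ?A. moebius_mu d) = (\<Sum>d\<in>?A. - moebius_mu d)"
    using inj p by (simp add: sum.reindex moebius_mu_prime_mult)
  finally show ?thesis using False by (simp add: sum_negf)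
qed

text \<open>With \<open>n = e * m\<close>, substituting \<open>k = n div d\<close> turns the sum
  into the one over all divisors \<open>k\<close> of \<open>m\<close>.\<close>

lemma sum_moebius_mu_multiples:
  assumes "n > 0" "e dvd n"
  shows "(\<Sum>d | e dvd d \<and> d dvd n. moebius_mu (n div d)) = (if e = n then 1 else 0)"
proof -
  obtain m where m: "n = e * m" using assms by blast
  with assms have pos: "e > 0" "m > 0" by auto
  have "(\<Sum>d | e dvd d \<and> d dvd n. moebius_mu (n div d)) = (\<Sum>k | k dvd m. moebius_mu k)"
    using pos unfolding m
    by (intro sum.reindex_bij_witness[of _ "\<lambda>k. e * (m div k)" "\<lambda>d. e * m div d"])
      (auto elim!: dvdE)
  also have "\<dots> = (if e = n then 1 else 0)" using sum_moebius_mu[OF pos(2)] pos m by simp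
  finally show ?thesis .
qed

text \<open>After the summations are exchanged, the coefficient of \<open>f e\<close> is the sum
  over the multiples of \<open>e\<close> dividing \<open>n\<close>, which is nonzero only for
  \<open>e = n\<close>.\<close>

lemma moebius_inversion:
  fixes f g :: "nat \<Rightarrow> int"
  assumes "n > 0" and g: "\<And>d. d dvd n \<Longrightarrow> g d = (\<Sum>e | e dvd d. f e)"
  shows "f n = (\<Sum>d | d dvd n. moebius_mu (n div d) * g d)"
proof -
  have fin: "finite {d. d dvd n}" using assms by simp
  have "(\<Sum>d | d dvd n. moebius_mu (n div d) * g d) =
      (\<Sum>d | d dvd n. \<Sum>e | e dvd n \<and> e dvd d. moebius_mu (n div d) * f e)"
  \<comment> \<open>Writing \<open>e dvd n\<close> into the inner sum lets both indices range over
    the divisors of \<open>n\<close>, linked by \<open>e dvd d\<close>, as the exchange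
    requires.\<close>
  proof (rule sum.cong)
    fix d assume d: "d \<in> {d. d dvd n}"
    then have "{e. e dvd n \<and> e dvd d} = {e. e dvd d}" by (auto intro: dvd_trans)
    with d show "moebius_mu (n div d) * g d =
        (\<Sum>e | e dvd n \<and> e dvd d. moebius_mu (n div d) * f e)"
      by (simp add: g sum_distrib_left)
  qed simp
  also have "\<dots> = (\<Sum>e | e dvd n. \<Sum>d | d dvd n \<and> e dvd d. moebius_mu (n div d) * f e)"
    using sum.swap_restrict[OF fin fin, of "\<lambda>d e. moebius_mu (n div d) * f e" "\<lambda>d e. e dvd d"]
    by simp
  also have "\<dots> = (\<Sum>e | e dvd n. if e = n then f e else 0)"
  proof (rule sum.cong)
    fix e assume e: "e \<in> {e. e dvd n}"
    have "(\<Sum>d | d dvd n \<and> e dvd d. moebius_mu (n div d) * f e) =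
        (\<Sum>d | e dvd d \<and> d dvd n. moebius_mu (n div d)) * f e"
      by (simp add: sum_distrib_right conj_commute)
    with e sum_moebius_mu_multiples[OF assms(1), of e]
    show "(\<Sum>d | d dvd n \<and> e dvd d. moebius_mu (n div d) * f e) = (if e = n then f e else 0)"
      by simp
  qed simp
  also have "\<dots> = f n" using fin by simp
  finally show ?thesis by simp
qed

theorem corollary1p2:
  fixes n :: nat
  assumes "n > 0"
  shows "int (count_max_primitive n) =
    (\<Sum>d | d dvd n. moebius_mu (n div d) * int (count_frobenius d))"
proof (rule moebius_inversion[OF assms])
  fix d assume "d dvd n"
  with assms have "d > 0" by (auto intro: Nat.gr0I)
  then show "int (count_frobenius d) = (\<Sum>e | e dvd d. int (count_max_primitive e))"
    by (simp add: count_frobenius_eq_sum_count_max_primitive)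
qed

end
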